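(* Let $s=\sigma+it$ with $\sigma>0$, let $\chi$ be a non-principal Dirichlet character modulo $p^a$ with $p$ prime and $a\ge1$, let $b=\lceil a/2\rceil$, and let $u_0$ and $v_0$ be any integers satisfying $v_0\ge u_0\ge 2\max\{6,\sqrt{\mathfrak{q}(s)},\sigma\}$. Then for any integers $M\ge v_0$ and $m\ge0$ we have $$L(s,\chi)=\sum_{n=1}^{v_0-1}\frac{\chi(n)}{n^s}+\sum_{r=0}^R\frac{B_r(s,\chi,m)}{v_r^s}+\mathcal{T}_{M,m}(s,\chi)+\mathcal{R}_M(s,\chi),$$ where $|\mathcal{T}_{M,m}(s,\chi)|\le\epsilon_m(s,u_0)\,\mathcal{B}_M(s,\chi,u_0,v_0)$. Moreover $R<2u_0\log(M/v_0)+1$.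
   Context: $L(s,\chi)$ is the Dirichlet $L$-function (for non-principal $\chi$ and $\sigma>0$ it equals the convergent series $\sum_n\chi(n)n^{-s}$). $\mathfrak{q}(s):=|s|+3$. For $M\ge1$, $\mathcal{R}_M(s,\chi)$ is defined by $L(s,\chi)=\sum_{1\le n<M}\chi(n)n^{-s}+\mathcal{R}_M(s,\chi)$, and $\mathcal{T}_{M,m}(s,\chi)$ is defined by the displayed identity in the claim. Let $f_s(z):=e^{sz}/(1+z)^s=e^{sz-s\log(1+z)}$ for $|z|<1$ (principal branch, $f_s(0)=1$), $g_K(z):=\sum_{k=0}^{K-1}e^{kz}$ (an empty sum, i.e. $0$, if $K\le0$), and $g_K(z,\chi,v):=\sum_{0\le k<K}\chi(v+k)e^{kz}$; superscripts $(j)$ denote $j$-th derivatives in $z$. Given integers $u_0\ge1$, $v_0\ge u_0$, $M\ge v_0$: set $K_r=\lceil v_r/u_0\rceil$, $v_{r+1}=v_r+K_r$; let $R$ be the largest integer with $v_R<M$, and $K_R:=\min\{\lceil v_R/u_0\rceil,M-v_R\}$ (so $v_R+K_R=M$). Define $$B_r(s,\chi,m):=\sum_{j=0}^m\frac{f_s^{(j)}(0)}{j!}\frac{g_{K_r}^{(j)}(-s/v_r,\chi,v_r)}{v_r^j}.$$ Let $L\in[0,p^{a-b})$ be the integer with $\chi(1+p^b)=e^{2\pi iL/p^{a-b}}$. For $0\le d<p^b$ let $H_{r,d}:=\lceil (K_r-d)/p^b\rceil$ and, when $\gcd(v_r+d,p)=1$, $w_{r,d}:=2\pi\,\overline{v_r+d}\,L/p^{a-b}$,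 where $\overline{v_r+d}(v_r+d)\equiv1\pmod{p^a}$ (and $w_{r,d}:=0$ otherwise). Define $$\mathcal{B}_M(s,\chi,u_0,v_0):=\sum_{r=0}^R\sum_{d=0}^{p^b-1}\delta_{\gcd(v_r+d,p)=1}\min\{e^{-\sigma d/v_r}g_{H_{r,d}}(-p^b\sigma/v_r),\,|\csc(w_{r,d}/2-p^bt/(2v_r))|\}\,v_r^{-\sigma},$$ where $\delta_{\gcd(v_r+d,p)=1}$ is $1$ if $\gcd(v_r+d,p)=1$ and $0$ otherwise. Finally $$\epsilon_m(s,u):=\begin{cases}\dfrac{3.5\,e^{0.78(m+1)}}{(m+1)^{(m+1)/2}}\dfrac{|s|^{(m+1)/2}}{u^{m+1}}, & m\le|s|/4,\\[2mm]\dfrac{2^me^{0.194|s|}}{u^m}, & m>|s|/4.\end{cases}$$ *)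

theory Defs
  imports
    "HOL-Complex_Analysis.Complex_Analysis"
    "HOL-Number_Theory.Number_Theory"
begin

definition dirichlet_character :: "nat \<Rightarrow> (nat \<Rightarrow> complex) \<Rightarrow> bool" where
  "dirichlet_character q chi \<longleftrightarrow>
     (\<forall>n. chi (n + q) = chi n) \<and>
     (\<forall>m n. chi (m * n) = chi m * chi n) \<and>
     (\<forall>n. chi n \<noteq> 0 \<longleftrightarrow> coprime n q)"

definition principal_character :: "nat \<Rightarrow> nat \<Rightarrow> complex" where
  "principal_character q n = (if coprime n q then 1 else 0)"

(* Only meaningful where the series converges; for non-principal chi this is Re s > 0,
   where the (conditionally convergent) series equals the Dirichlet L-function. *)
definition dirichlet_L :: "complex \<Rightarrow> (nat \<Rightarrow> complex) \<Rightarrow> complex" where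
  "dirichlet_L s chi = (\<Sum>n. chi (Suc n) / of_nat (Suc n) powr s)"

definition L_remainder :: "nat \<Rightarrow> complex \<Rightarrow> (nat \<Rightarrow> complex) \<Rightarrow> complex" where
  "L_remainder M s chi = dirichlet_L s chi - (\<Sum>n=1..<M. chi n / of_nat n powr s)"

definition frakq :: "complex \<Rightarrow> real" where
  "frakq s = cmod s + 3"

(* Used only through its derivatives at 0, so its values for cmod z \<ge> 1 are irrelevant. *)
definition fs :: "complex \<Rightarrow> complex \<Rightarrow> complex" where
  "fs s z = exp (s * z - s * Ln (1 + z))"

definition gsum :: "int \<Rightarrow> real \<Rightarrow> real" where
  "gsum K x = (\<Sum>k<nat K. exp (real k * x))"

definition gsum_char :: "nat \<Rightarrow> (nat \<Rightarrow> complex) \<Rightarrow> nat \<Rightarrow> complex \<Rightarrow> complex" where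
  "gsum_char K chi v z = (\<Sum>k<K. chi (v + k) * exp (of_nat k * z))"

fun vseq :: "nat \<Rightarrow> nat \<Rightarrow> nat \<Rightarrow> nat" where
  "vseq u0 v0 0 = v0"
| "vseq u0 v0 (Suc r) = vseq u0 v0 r + nat \<lceil>real (vseq u0 v0 r) / real u0\<rceil>"

(* For M = v0 no r satisfies vseq u0 v0 r < M. We then use one block of length 0 starting
   at v0, so that vseq + Kblock at the last index is M in this case too. *)
definition Rlast :: "nat \<Rightarrow> nat \<Rightarrow> nat \<Rightarrow> nat" where
  "Rlast u0 v0 M = (if M = v0 then 0 else (GREATEST r. vseq u0 v0 r < M))"

definition Kblock :: "nat \<Rightarrow> nat \<Rightarrow> nat \<Rightarrow> nat \<Rightarrow> nat" where
  "Kblock u0 v0 M r =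
     (if r = Rlast u0 v0 M
      then min (nat \<lceil>real (vseq u0 v0 r) / real u0\<rceil>) (M - vseq u0 v0 r)
      else nat \<lceil>real (vseq u0 v0 r) / real u0\<rceil>)"

definition Bterm ::
  "nat \<Rightarrow> nat \<Rightarrow> nat \<Rightarrow> nat \<Rightarrow> complex \<Rightarrow> (nat \<Rightarrow> complex) \<Rightarrow> nat \<Rightarrow> complex" where
  "Bterm u0 v0 M r s chi m =
     (let v = vseq u0 v0 r; K = Kblock u0 v0 M r in
      \<Sum>j=0..m. (deriv ^^ j) (fs s) 0 / fact j *
               ((deriv ^^ j) (gsum_char K chi v) (- s / of_nat v) / of_nat v ^ j))"

definition T_remainder ::
  "nat \<Rightarrow> nat \<Rightarrow> nat \<Rightarrow> nat \<Rightarrow> complex \<Rightarrow> (nat \<Rightarrow> complex) \<Rightarrow> complex" where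
  "T_remainder u0 v0 M m s chi =
     dirichlet_L s chi
     - (\<Sum>n=1..<v0. chi n / of_nat n powr s)
     - (\<Sum>r=0..Rlast u0 v0 M. Bterm u0 v0 M r s chi m / of_nat (vseq u0 v0 r) powr s)
     - L_remainder M s chi"

definition bexp :: "nat \<Rightarrow> nat" where
  "bexp a = nat \<lceil>real a / 2\<rceil>"

definition Lindex :: "nat \<Rightarrow> nat \<Rightarrow> (nat \<Rightarrow> complex) \<Rightarrow> nat" where
  "Lindex p a chi =
     (THE l. l < p ^ (a - bexp a) \<and>
             chi (1 + p ^ bexp a) = exp (2 * of_real pi * \<i> * of_nat l / of_nat (p ^ (a - bexp a))))"

definition Hcount :: "nat \<Rightarrow> nat \<Rightarrow> nat \<Rightarrow> nat \<Rightarrow> nat \<Rightarrow> nat \<Rightarrow> nat \<Rightarrow> int" where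
  "Hcount p a u0 v0 M r d =
     \<lceil>(real (Kblock u0 v0 M r) - real d) / real (p ^ bexp a)\<rceil>"

definition wphase :: "nat \<Rightarrow> nat \<Rightarrow> (nat \<Rightarrow> complex) \<Rightarrow> nat \<Rightarrow> nat \<Rightarrow> nat \<Rightarrow> nat \<Rightarrow> real" where
  "wphase p a chi u0 v0 r d =
     (let n = vseq u0 v0 r + d in
      if coprime n p
      then 2 * pi * real_of_int (modular_inverse (int (p ^ a)) (int n)) * real (Lindex p a chi)
             / real (p ^ (a - bexp a))
      else 0)"

(* min {x, |csc y|}, where |csc y| is infinite if sin y = 0 *)
definition min_csc :: "real \<Rightarrow> real \<Rightarrow> real" where
  "min_csc x y = (if sin y = 0 then x else min x (1 / \<bar>sin y\<bar>))"

definition Bbound ::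
  "nat \<Rightarrow> nat \<Rightarrow> nat \<Rightarrow> complex \<Rightarrow> (nat \<Rightarrow> complex) \<Rightarrow> nat \<Rightarrow> nat \<Rightarrow> real" where
  "Bbound p a M s chi u0 v0 =
     (\<Sum>r=0..Rlast u0 v0 M. \<Sum>d<p ^ bexp a.
        let v = real (vseq u0 v0 r) in
        if coprime (vseq u0 v0 r + d) p
        then min_csc
               (exp (- Re s * real d / v) *
                gsum (Hcount p a u0 v0 M r d) (- real (p ^ bexp a) * Re s / v))
               (wphase p a chi u0 v0 r d / 2 - real (p ^ bexp a) * Im s / (2 * v))
             * v powr (- Re s)
        else 0)"

definition eps :: "nat \<Rightarrow> complex \<Rightarrow> real \<Rightarrow> real" where
  "eps m s u =
     (if real m \<le> cmod s / 4
      then 3.5 * exp (0.78 * (real m + 1)) / (real m + 1) powr ((real m + 1) / 2)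
             * (cmod s powr ((real m + 1) / 2) / u ^ (m + 1))
      else 2 ^ m * exp (0.194 * cmod s) / u ^ m)"

end

(* Put v = v_r and z = k/v. Then (v+k)^(-s) = v^(-s) e^(-sz) f_s(z), and expanding f_s in its
   Taylor series at 0 up to degree m turns the sum over the block [v, v + K_r) into B_r / v^s, up to
   the terms of degree j > m. Since |log(1+z) - z| <= 0.776 |z|^2 for |z| <= 1/2, Cauchy's inequality
   for f_s - 1 on the circle of radius rho <= 1/2 bounds the j-th Taylor coefficient by
   (exp(0.776 |s| rho^2) - 1) / rho^j; the radius rho = sqrt((m+1)/|s|) if that is at most 1/2, and
   rho = 1/2 otherwise, gives the factor eps_m.

   The j-th term is paired with sum_k chi(v+k) (k/v)^j e^(-sk/v). Splitting k into residue classes d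
   modulo q = p^b, the character is chi(v+d) e^(i w h) along k = d + q h, because
   (1+q)^x = 1 + qx mod p^a. Abel summation with the increasing weights (k/v)^j <= u_0^(-j) leaves
   damped geometric sums, bounded either trivially or, by Abel summation with the decreasing
   damping factor, by the cosecant. *)
theory Submission
  imports Defs
begin

section \<open>Taylor coefficients of \<open>fs\<close>\<close>

lemma geometric_tail_bound:
  fixes f :: "nat \<Rightarrow> complex"
  assumes f: "f sums l" and le: "\<And>j. j \<ge> n \<Longrightarrow> norm (f j) \<le> C * x ^ j"
    and x: "0 \<le> x" "x < 1"
  shows "norm (l - (\<Sum>j<n. f j)) \<le> C * x ^ n / (1 - x)"
proof -
  have g: "(\<lambda>i. C * x ^ n * x ^ i) sums (C * x ^ n * (1 / (1 - x)))"
    by (intro sums_mult geometric_sums) (use x in simp)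
  have tail: "(\<lambda>i. f (i + n)) sums (l - (\<Sum>j<n. f j))"
    using f by (simp add: sums_iff_shift)
  have "norm (\<Sum>i. f (i + n)) \<le> (\<Sum>i. C * x ^ n * x ^ i)"
  proof (rule norm_suminf_le)
    show "norm (f (i + n)) \<le> C * x ^ n * x ^ i" for i
      using le[of "i + n"] by (simp add: power_add mult_ac)
    show "summable (\<lambda>i. C * x ^ n * x ^ i)"
      using g by (simp add: sums_iff)
  qed
  then show ?thesis
    using tail g by (simp add: sums_iff)
qed

text \<open>Cutting the logarithm series after degree 5 leaves at most 181/240 from the polynomial
  part and 1/48 from the tail, 0.775 in total. A quarter of 0.776 is the 0.194 in
  \<open>eps\<close>.\<close>

lemma norm_Ln_one_plus_minus_le:
  assumes "norm z \<le> 1 / 2"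
  shows "norm (z - Ln (1 + z)) \<le> 0.776 * (norm z)\<^sup>2"
proof -
  define r where "r = norm z"
  \<comment> \<open>At \<open>n = 0\<close> division by zero gives the value 0, so the series has no
    constant term.\<close>
  define f where "f n = - ((- z) ^ n) / of_nat n" for n
  have r: "0 \<le> r" "r \<le> 1 / 2"
    using assms by (auto simp: r_def)
  have "norm (Ln (1 + z) - (\<Sum>j<6. f j)) \<le> 1 / 6 * r ^ 6 / (1 - r)"
  proof (rule geometric_tail_bound)
    show "f sums Ln (1 + z)"
      unfolding f_def by (rule Ln_series') (use r in \<open>simp add: r_def\<close>)
    show "norm (f j) \<le> 1 / 6 * r ^ j" if "6 \<le> j" for j
    proof -
      have "norm (f j) = r ^ j * (1 / real j)"
        by (simp add: f_def r_def norm_divide norm_power)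
      also have "\<dots> \<le> r ^ j * (1 / 6)"
        by (intro mult_left_mono) (use that r in \<open>auto simp: field_simps\<close>)
      finally show ?thesis by simp
    qed
  qed (use r in auto)
  also have "\<dots> \<le> r\<^sup>2 / 48"
  proof -
    have "1 / 6 * r ^ 6 / (1 - r) = r\<^sup>2 * (r ^ 4 / (6 * (1 - r)))"
      by (simp add: field_simps flip: power_add)
    also have "r ^ 4 / (6 * (1 - r)) \<le> (1 / 2) ^ 4 / (6 * (1 - 1 / 2))"
      by (intro frac_le power_mono) (use r in auto)
    finally show ?thesis by (simp add: mult_left_mono power4_eq_xxxx)
  qed
  finally have 1: "norm (Ln (1 + z) - (\<Sum>j<6. f j)) \<le> r\<^sup>2 / 48" .
  have "norm (z - (\<Sum>j<6. f j)) = norm (z\<^sup>2 * (1 / 2 - z / 3 + z ^ 2 / 4 - z ^ 3 / 5))"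
    by (rule arg_cong[where f = norm])
      (simp add: f_def lessThan_nat_numeral lessThan_Suc field_simps power2_eq_square power3_eq_cube eval_nat_numeral)
  also have "\<dots> = r\<^sup>2 * norm (1 / 2 - z / 3 + z ^ 2 / 4 - z ^ 3 / 5)"
    by (simp add: norm_mult norm_power r_def)
  also have "norm (1 / 2 - z / 3 + z ^ 2 / 4 - z ^ 3 / 5) \<le> 1 / 2 + r / 3 + r ^ 2 / 4 + r ^ 3 / 5"
    unfolding r_def
    by (intro order_trans[OF norm_triangle_ineq4] order_trans[OF norm_triangle_ineq] add_mono)
      (auto simp: norm_divide norm_power)
  also have "\<dots> \<le> 1 / 2 + (1 / 2) / 3 + (1 / 2) ^ 2 / 4 + (1 / 2) ^ 3 / 5"
    by (intro add_mono divide_right_mono power_mono) (use r in auto)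
  finally have "norm (z - (\<Sum>j<6. f j)) \<le> r\<^sup>2 * (1 / 2 + (1 / 2) / 3 + (1 / 2) ^ 2 / 4 + (1 / 2) ^ 3 / 5)"
    by (simp add: mult_left_mono)
  then have 2: "norm (z - (\<Sum>j<6. f j)) \<le> 181 / 240 * r\<^sup>2"
    by (simp add: power_divide mult.commute)
  have "norm (z - Ln (1 + z)) \<le> norm (z - (\<Sum>j<6. f j)) + norm (Ln (1 + z) - (\<Sum>j<6. f j))"
    using norm_triangle_ineq4[of "z - (\<Sum>j<6. f j)" "Ln (1 + z) - (\<Sum>j<6. f j)"] by simp
  with 1 2 zero_le_power2[of r] have "norm (z - Ln (1 + z)) \<le> 97 / 125 * r\<^sup>2"
    by linarith
  then show ?thesis
    unfolding r_def[symmetric] by simp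
qed

text \<open>Termwise comparison of the exponential series without its constant term.\<close>

lemma norm_exp_minus_one_le: "norm (exp w - 1) \<le> exp (norm w) - 1" for w :: complex
proof -
  have 1: "(\<lambda>n. w ^ Suc n /\<^sub>R fact (Suc n)) sums (exp w - 1)"
    using exp_converges[of w] by (subst sums_Suc_iff) simp
  have 2: "(\<lambda>n. norm w ^ Suc n /\<^sub>R fact (Suc n)) sums (exp (norm w) - 1)"
    using exp_converges[of "norm w"] by (subst sums_Suc_iff) simp
  have "norm (\<Sum>n. w ^ Suc n /\<^sub>R fact (Suc n)) \<le> (\<Sum>n. norm w ^ Suc n /\<^sub>R fact (Suc n))"
    by (rule norm_suminf_le) (use 2 in \<open>auto simp: sums_iff norm_power norm_mult\<close>)
  with 1 2 show ?thesis by (simp add: sums_iff)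
qed

lemma fs_holomorphic: "fs s holomorphic_on ball 0 1"
proof -
  have "1 + z \<notin> \<real>\<^sub>\<le>\<^sub>0" if "norm z < 1" for z :: complex
  proof
    assume "1 + z \<in> \<real>\<^sub>\<le>\<^sub>0"
    then have "Re z \<le> -1" by (auto simp: complex_nonpos_Reals_iff)
    with abs_Re_le_cmod[of z] that show False by linarith
  qed
  then show ?thesis
    unfolding fs_def by (intro holomorphic_intros) auto
qed

lemma fs_sums:
  assumes "norm z < 1"
  shows "(\<lambda>j. (deriv ^^ j) (fs s) 0 / fact j * z ^ j) sums fs s z"
  using holomorphic_power_series[OF fs_holomorphic, of z s] assms by simp

text \<open>Subtracting 1 does not affect derivatives of order \<open>j > 0\<close>, and it makes
  the Cauchy bound vanish as \<open>s\<close> tends to 0. This matters for \<open>m = 0\<close>,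
  where \<open>eps\<close> decays like the square root of \<open>norm s\<close>.\<close>

lemma fs_coeff_bound:
  assumes "0 < \<rho>" "\<rho> \<le> 1 / 2" "j > 0"
  shows "norm ((deriv ^^ j) (fs s) 0 / fact j) \<le> (exp (0.776 * norm s * \<rho>\<^sup>2) - 1) / \<rho> ^ j"
proof -
  define h where "h z = fs s z - 1" for z
  have hol: "h holomorphic_on ball 0 1"
    unfolding h_def by (intro holomorphic_intros fs_holomorphic)
  have sub: "cball 0 \<rho> \<subseteq> ball (0 :: complex) 1"
    using assms by auto
  have "norm ((deriv ^^ j) h 0) \<le> fact j * (exp (0.776 * norm s * \<rho>\<^sup>2) - 1) / \<rho> ^ j"
  proof (rule Cauchy_inequality)
    show "h holomorphic_on ball 0 \<rho>"
      by (rule holomorphic_on_subset[OF hol]) (use assms in auto)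
    show "continuous_on (cball 0 \<rho>) h"
      by (rule holomorphic_on_imp_continuous_on[OF holomorphic_on_subset[OF hol sub]])
    fix z :: complex
    assume z: "norm (0 - z) = \<rho>"
    have "norm (h z) \<le> exp (norm (s * (z - Ln (1 + z)))) - 1"
      using norm_exp_minus_one_le[of "s * (z - Ln (1 + z))"] by (simp add: h_def fs_def algebra_simps)
    also have "norm (s * (z - Ln (1 + z))) \<le> norm s * (0.776 * \<rho>\<^sup>2)"
      unfolding norm_mult
      by (intro mult_left_mono) (use norm_Ln_one_plus_minus_le[of z] z assms in auto)
    finally show "norm (h z) \<le> exp (0.776 * norm s * \<rho>\<^sup>2) - 1"
      by (simp add: mult_ac)
  qed (use assms in auto)
  also have "(deriv ^^ j) h 0 = (deriv ^^ j) (fs s) 0"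
  proof -
    have "(deriv ^^ j) h 0 = (deriv ^^ j) (fs s) 0 - (deriv ^^ j) (\<lambda>_. 1) 0"
      unfolding h_def
      by (rule higher_deriv_diff[of _ "ball 0 1"]) (auto intro: fs_holomorphic)
    then show ?thesis using assms by simp
  qed
  finally show ?thesis
    by (simp add: norm_divide field_simps)
qed

section \<open>Choice of the Cauchy radius and comparison with \<open>eps\<close>\<close>

text \<open>Here \<open>n\<close> stands for \<open>m + 1\<close>. The radius is chosen so that
  \<open>S * \<rho>\<^sup>2 = n\<close>, and the bound on \<open>u\<close> gives
  \<open>\<rho> * u \<ge> 2\<close>, so the geometric factor costs at most 2; the constants 3.5 and
  0.78 absorb it.\<close>

lemma eps_case_small_disc:
  fixes S u :: real
  assumes S: "S > 0" and u: "u \<ge> 2 * sqrt (S + 3)" and n: "n > 0" "real n \<le> S / 4"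
  defines "\<rho> \<equiv> sqrt (n / S)"
  shows "1 < \<rho> * u \<and>
    (exp (0.776 * S * \<rho>\<^sup>2) - 1) * (1 / (\<rho> * u)) ^ n / (1 - 1 / (\<rho> * u))
      \<le> 3.5 * exp (0.78 * n) / n powr (n / 2) * (S powr (n / 2) / u ^ n)"
proof -
  have rho: "\<rho> > 0" using n S by (simp add: \<rho>_def)
  have rho2: "\<rho>\<^sup>2 = n / S" using n S by (simp add: \<rho>_def)
  have "2 * 1 \<le> 2 * sqrt (n * (S + 3) / S)"
  proof -
    have "1 * S \<le> n * (S + 3)" by (rule mult_mono) (use n S in auto)
    then show ?thesis using S by simp
  qed
  also have "\<dots> = \<rho> * (2 * sqrt (S + 3))"
    by (simp add: \<rho>_def real_sqrt_mult[symmetric] real_sqrt_divide[symmetric])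
  also have "\<dots> \<le> \<rho> * u" using u rho by simp
  finally have ru: "2 \<le> \<rho> * u" by simp
  have u0: "u > 0" using u S by (smt (verit) real_sqrt_gt_zero)
  have pow: "\<rho> ^ n = n powr (n / 2) / S powr (n / 2)"
  proof -
    have "\<rho> ^ n = \<rho> powr n" using rho by (simp add: powr_realpow)
    also have "\<dots> = ((n / S) powr (1 / 2)) powr n"
      unfolding \<rho>_def by (simp only: powr_half_sqrt[of "n / S", OF divide_nonneg_pos[OF of_nat_0_le_iff S]])
    also have "\<dots> = n powr (n / 2) / S powr (n / 2)"
      using n S by (simp add: powr_powr powr_divide)
    finally show ?thesis .
  qed
  have "(exp (0.776 * S * \<rho>\<^sup>2) - 1) * (1 / (\<rho> * u)) ^ n / (1 - 1 / (\<rho> * u))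
      \<le> (exp (0.776 * n)) * (1 / (\<rho> * u)) ^ n / (1 / 2)"
    by (intro frac_le mult_right_mono) (use ru rho u0 S in \<open>auto simp: rho2 field_simps\<close>)
  also have "\<dots> = 2 * exp (0.776 * n) * (1 / (\<rho> * u)) ^ n" by simp
  also have "\<dots> \<le> 3.5 * exp (0.78 * n) * (1 / (\<rho> * u)) ^ n"
    by (intro mult_right_mono mult_mono) (use rho u0 in auto)
  also have "\<dots> = 3.5 * exp (0.78 * n) / n powr (n / 2) * (S powr (n / 2) / u ^ n)"
    by (simp add: power_divide power_mult_distrib pow)
  finally show ?thesis using ru by simp
qed

text \<open>For the radius 1/2, \<open>u \<ge> 12\<close> gives
  \<open>1 - 2 / u \<ge> 5 / 6\<close>, whence the factor 1.2.\<close>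

lemma tail_half_disc:
  fixes S u :: real
  assumes S: "S > 0" and u: "u \<ge> 12"
  shows "(exp (0.776 * S * (1 / 2)\<^sup>2) - 1) * (1 / (1 / 2 * u)) ^ n / (1 - 1 / (1 / 2 * u))
      \<le> 1.2 * (exp (0.194 * S) - 1) * 2 ^ n / u ^ n"
proof -
  define E where "E = exp (0.194 * S) - 1"
  have "E * (2 / u) ^ n / (1 - 2 / u) \<le> E * (2 / u) ^ n / (5 / 6)"
    by (intro divide_left_mono mult_nonneg_nonneg) (use S u in \<open>auto simp: E_def field_simps\<close>)
  moreover have "exp (0.776 * S * (1 / 2)\<^sup>2) - 1 = E" by (simp add: E_def power2_eq_square)
  ultimately show ?thesis unfolding E_def[symmetric] by (simp add: power_divide)
qed

text \<open>With \<open>n = m + 1\<close> this is the range where \<open>eps\<close> still uses its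
  first formula although \<open>sqrt (n / S)\<close> already exceeds 1/2, so the radius 1/2 has to
  serve.\<close>

lemma eps_case_transition:
  fixes S u :: real
  assumes S: "S > 0" and u: "u \<ge> 12" and n: "n > 0" "real n - 1 \<le> S / 4" "S / 4 < n"
  shows "1.2 * (exp (0.194 * S) - 1) * 2 ^ n / u ^ n
      \<le> 3.5 * exp (0.78 * n) / n powr (n / 2) * (S powr (n / 2) / u ^ n)"
proof -
  define x where "x = S / 4"
  have x: "x > 0" "x < n" "real n - 1 \<le> x" "S = 4 * x" using S n by (auto simp: x_def)
  have powS: "S powr (n / 2) / n powr (n / 2) = 2 ^ n * (x / n) powr (n / 2)"
  proof -
    have "S powr (n / 2) = 4 powr (n / 2) * x powr (n / 2)"
      using x by (simp add: powr_mult)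
    also have "4 powr (real n / 2) = (2 powr 2) powr (n / 2)" by simp
    also have "\<dots> = 2 ^ n" by (subst powr_powr) (simp add: powr_realpow)
    finally show ?thesis using x n by (simp add: powr_divide)
  qed
  \<comment> \<open>What remains once the common factor \<open>(2 / u) ^ n\<close> is
    removed.\<close>
  have "1.2 * (exp (0.776 * x) - 1) \<le> 3.5 * exp (0.78 * n) * (x / n) powr (n / 2)"
  proof (cases "n = 1")
    \<comment> \<open>For \<open>n = 1\<close>, \<open>x\<close> may be arbitrarily small. The
      inequality \<open>exp y - 1 \<le> y * exp y\<close> makes the left side of order
      \<open>x\<close>, which \<open>sqrt x\<close> dominates on \<open>x < 1\<close>.\<close>
    case True
    have "1 - 0.776 * x \<le> exp (- (0.776 * x))"
      using exp_ge_add_one_self[of "- (0.776 * x)"] by simp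
    then have "(1 - 0.776 * x) * exp (0.776 * x) \<le> exp (- (0.776 * x)) * exp (0.776 * x)"
      by (intro mult_right_mono) auto
    then have "exp (0.776 * x) - 1 \<le> 0.776 * x * exp (0.776 * x)"
      by (simp add: algebra_simps flip: exp_add)
    also have "\<dots> \<le> 1 * sqrt x * exp 0.78"
    proof (intro mult_mono)
      show "x \<le> sqrt x" using x True by (simp add: real_le_rsqrt power2_eq_square mult_left_le)
    qed (use x True in auto)
    finally have "1.2 * (exp (0.776 * x) - 1) \<le> 1.2 * (sqrt x * exp 0.78)" by simp
    also have "\<dots> \<le> 3.5 * (sqrt x * exp 0.78)" by (intro mult_right_mono) (use x in auto)
    finally show ?thesis using True x by (simp add: powr_half_sqrt mult_ac)
  next
    case False
    then have n2: "n \<ge> 2" using n by simp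
    \<comment> \<open>For \<open>n \<ge> 2\<close>, the bound \<open>x \<ge> n - 1\<close> keeps
      \<open>(x / n) powr (n / 2)\<close> above \<open>exp (- 1)\<close>, and 3.5 / 2.72 exceeds
      1.2.\<close>
    have "ln (n / x) \<le> n / x - 1" by (rule ln_le_minus_one) (use x n in simp)
    also have "\<dots> \<le> n / (real n - 1) - 1"
      by (intro diff_right_mono divide_left_mono) (use x n2 in auto)
    also have "\<dots> = 1 / (real n - 1)" using n2 by (simp add: field_simps)
    finally have "(n / 2) * ln (n / x) \<le> (n / 2) * (1 / (real n - 1))"
      by (intro mult_left_mono) auto
    also have "\<dots> \<le> 1" using n2 by (simp add: field_simps)
    finally have "exp (- 1) \<le> exp ((n / 2) * ln (x / n))"
      using x n by (simp add: ln_div algebra_simps)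
    also have "\<dots> = (x / n) powr (n / 2)" using x n by (simp add: powr_def)
    finally have pw: "exp (- 1) \<le> (x / n) powr (n / 2)" .
    have "1.2 \<le> 3.5 * exp (- 1 :: real)"
      using e_less_272 by (simp add: exp_minus field_simps)
    also have "\<dots> \<le> 3.5 * (x / n) powr (n / 2)" using pw by simp
    finally have c: "1.2 \<le> 3.5 * (x / n) powr (n / 2)" .
    have "1.2 * (exp (0.776 * x) - 1) \<le> 3.5 * (x / n) powr (n / 2) * exp (0.78 * n)"
    proof (intro mult_mono c)
      have "exp (0.776 * x) \<le> exp (0.78 * n)" using x by simp
      then show "exp (0.776 * x) - 1 \<le> exp (0.78 * n)" by (rule order_trans[rotated]) simp
    qed (use x in auto)
    then show ?thesis by (simp add: mult_ac)
  qed
  then have "1.2 * (exp (0.194 * S) - 1) * 2 ^ n / u ^ n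
      \<le> 3.5 * exp (0.78 * n) * (x / n) powr (n / 2) * 2 ^ n / u ^ n"
    using u x by (intro divide_right_mono mult_right_mono) auto
  also have "\<dots> = 3.5 * exp (0.78 * n) * (2 ^ n * (x / n) powr (n / 2)) / u ^ n"
    by simp
  also have "\<dots> = 3.5 * exp (0.78 * n) / n powr (n / 2) * (S powr (n / 2) / u ^ n)"
    unfolding powS[symmetric] by simp
  finally show ?thesis .
qed

text \<open>In case \<open>a\<close> the radius \<open>sqrt (Suc m / S)\<close> is at most 1/2; in
  the other two the radius is 1/2, compared with the first and the second formula of
  \<open>eps\<close> respectively.\<close>

lemma exists_disc_radius:
  assumes s: "s \<noteq> 0" and u: "u \<ge> 12" "u \<ge> 2 * sqrt (frakq s)"
  obtains \<rho> where "0 < \<rho>" "\<rho> \<le> 1 / 2" "1 < \<rho> * u"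
    "(exp (0.776 * norm s * \<rho>\<^sup>2) - 1) * (1 / (\<rho> * u)) ^ Suc m / (1 - 1 / (\<rho> * u)) \<le> eps m s u"
proof -
  define S where "S = norm s"
  have S: "S > 0" using s by (simp add: S_def)
  have nm: "real (Suc m) = real m + 1" by simp
  consider (a) "real (Suc m) \<le> S / 4" | (b) "real m \<le> S / 4" "S / 4 < Suc m" | (c) "real m > S / 4"
    by linarith
  then show ?thesis
  proof cases
    case a
    show ?thesis
    proof (rule that[of "sqrt (Suc m / S)"])
      show "sqrt (Suc m / S) \<le> 1 / 2"
        using a S by (intro real_le_lsqrt) (auto simp: power2_eq_square field_simps)
      show "0 < sqrt (Suc m / S)" using S by simp
      show "1 < sqrt (Suc m / S) * u"
        "(exp (0.776 * norm s * (sqrt (Suc m / S))\<^sup>2) - 1) * (1 / (sqrt (Suc m / S) * u)) ^ Suc m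
          / (1 - 1 / (sqrt (Suc m / S) * u)) \<le> eps m s u"
        using eps_case_small_disc[of S u "Suc m"] a u S unfolding eps_def S_def[symmetric] nm
        by (simp_all add: frakq_def S_def[symmetric] add_ac)
    qed
  next
    case b
    show ?thesis
    proof (rule that[of "1 / 2"])
      have "(exp (0.776 * S * (1 / 2)\<^sup>2) - 1) * (1 / (1 / 2 * u)) ^ Suc m / (1 - 1 / (1 / 2 * u))
        \<le> 3.5 * exp (0.78 * Suc m) / Suc m powr (Suc m / 2) * (S powr (Suc m / 2) / u ^ Suc m)"
        by (rule order_trans[OF tail_half_disc eps_case_transition]) (use S u b in auto)
      then show "(exp (0.776 * norm s * (1 / 2)\<^sup>2) - 1) * (1 / (1 / 2 * u)) ^ Suc m
          / (1 - 1 / (1 / 2 * u)) \<le> eps m s u"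
        using b(1) unfolding eps_def S_def[symmetric] nm by simp
    qed (use u in auto)
  next
    case c
    show ?thesis
    proof (rule that[of "1 / 2"])
      have "(exp (0.776 * S * (1 / 2)\<^sup>2) - 1) * (1 / (1 / 2 * u)) ^ Suc m / (1 - 1 / (1 / 2 * u))
        \<le> 1.2 * (exp (0.194 * S) - 1) * 2 ^ Suc m / u ^ Suc m"
        by (rule tail_half_disc) (use S u in auto)
      \<comment> \<open>The tail has one power of \<open>2 / u\<close> more than \<open>eps\<close>
        in this range; this spare power absorbs 1.2.\<close>
      also have "\<dots> = (2.4 / u) * (exp (0.194 * S) - 1) * (2 ^ m / u ^ m)"
        using u by (simp add: field_simps)
      also have "\<dots> \<le> 1 * exp (0.194 * S) * (2 ^ m / u ^ m)"
        by (intro mult_mono) (use u S in auto)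
      finally show "(exp (0.776 * norm s * (1 / 2)\<^sup>2) - 1) * (1 / (1 / 2 * u)) ^ Suc m
          / (1 - 1 / (1 / 2 * u)) \<le> eps m s u"
        using c unfolding eps_def S_def[symmetric] by (simp add: mult_ac)
    qed (use u in auto)
  qed
qed

text \<open>In the application \<open>A j\<close> is the damped character sum of a block with
  weights \<open>(k / v) ^ j\<close>. Its bound and the Cauchy bound together decay geometrically
  with ratio \<open>1 / (\<rho> * u)\<close>.\<close>

lemma tail_bound:
  fixes A :: "nat \<Rightarrow> complex"
  assumes s: "s \<noteq> 0" and u: "u \<ge> 12" "u \<ge> 2 * sqrt (frakq s)"
    and sums: "(\<lambda>j. (deriv ^^ j) (fs s) 0 / fact j * A j) sums l"
    and A: "\<And>j. norm (A j) \<le> D / u ^ j" and D: "D \<ge> 0"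
  shows "norm (l - (\<Sum>j=0..m. (deriv ^^ j) (fs s) 0 / fact j * A j)) \<le> eps m s u * D"
proof -
  obtain \<rho> where rho: "0 < \<rho>" "\<rho> \<le> 1 / 2" "1 < \<rho> * u" and
    le: "(exp (0.776 * norm s * \<rho>\<^sup>2) - 1) * (1 / (\<rho> * u)) ^ Suc m / (1 - 1 / (\<rho> * u)) \<le> eps m s u"
    by (rule exists_disc_radius[OF s u])
  define E where "E = exp (0.776 * norm s * \<rho>\<^sup>2) - 1"
  have E: "E \<ge> 0" by (simp add: E_def)
  have "norm (l - (\<Sum>j<Suc m. (deriv ^^ j) (fs s) 0 / fact j * A j))
      \<le> E * D * (1 / (\<rho> * u)) ^ Suc m / (1 - 1 / (\<rho> * u))"
  proof (rule geometric_tail_bound[OF sums])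
    fix j assume "Suc m \<le> j"
    then have "norm ((deriv ^^ j) (fs s) 0 / fact j) * norm (A j) \<le> E / \<rho> ^ j * (D / u ^ j)"
      unfolding E_def using rho
      by (intro mult_mono A fs_coeff_bound) auto
    then show "norm ((deriv ^^ j) (fs s) 0 / fact j * A j) \<le> E * D * (1 / (\<rho> * u)) ^ j"
      by (simp only: norm_mult power_divide power_mult_distrib) (simp add: norm_divide)
  qed (use rho u in auto)
  also have "\<dots> = (E * (1 / (\<rho> * u)) ^ Suc m / (1 - 1 / (\<rho> * u))) * D" by simp
  also have "\<dots> \<le> eps m s u * D" using le D unfolding E_def by (intro mult_right_mono)
  finally show ?thesis by (simp only: atLeast0AtMost lessThan_Suc_atMost)
qed

section \<open>Damped exponential sums\<close>

text \<open>Summation by parts: the differences of \<open>a\<close> are nonnegative, so replacing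
  every partial sum by \<open>C\<close> leaves a telescoping sum.\<close>

lemma abel_bound_decreasing:
  fixes a :: "nat \<Rightarrow> real" and b :: "nat \<Rightarrow> complex"
  assumes a: "\<And>i. a (Suc i) \<le> a i" "\<And>i. 0 \<le> a i"
    and C: "\<And>k. k \<le> n \<Longrightarrow> norm (\<Sum>i<k. b i) \<le> C"
  shows "norm (\<Sum>i<n. of_real (a i) * b i) \<le> a 0 * C"
proof -
  have "(\<Sum>i<n. of_real (a i) * b i)
      = of_real (a n) * (\<Sum>i<n. b i) + (\<Sum>i<n. of_real (a i - a (Suc i)) * (\<Sum>j<Suc i. b j))"
    by (induction n) (simp_all add: algebra_simps)
  also have "norm \<dots> \<le> a n * C + (\<Sum>i<n. (a i - a (Suc i)) * C)"
    by (intro order_trans[OF norm_triangle_ineq] add_mono sum_norm_le)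
      (auto simp: norm_mult a simp del: sum.lessThan_Suc of_real_diff intro!: mult_mono C)
  also have "\<dots> = a 0 * C"
    by (induction n) (simp_all add: algebra_simps)
  finally show ?thesis .
qed

text \<open>Reversing the order of summation makes the weights decreasing and turns final segments
  into initial ones, which is why the hypothesis concerns tails of \<open>b\<close>.\<close>

lemma abel_bound_increasing:
  fixes a :: "nat \<Rightarrow> real" and b :: "nat \<Rightarrow> complex"
  assumes a: "mono a" "\<And>i. 0 \<le> a i"
    and C: "\<And>k. k \<le> n \<Longrightarrow> norm (\<Sum>i=k..<n. b i) \<le> C"
  shows "norm (\<Sum>i<n. of_real (a i) * b i) \<le> a (n - 1) * C"
proof -
  have "(\<Sum>i<n. of_real (a i) * b i) = (\<Sum>i<n. of_real (a (n - Suc i)) * b (n - Suc i))"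
    by (rule sum.nat_diff_reindex[symmetric])
  also have "norm \<dots> \<le> a (n - Suc 0) * C"
  proof (rule abel_bound_decreasing)
    show "norm (\<Sum>i<k. b (n - Suc i)) \<le> C" if "k \<le> n" for k
    proof -
      have "(\<Sum>i<k. b (n - Suc i)) = (\<Sum>i=n - k..<n. b i)"
        by (rule sum.reindex_bij_witness[of _ "\<lambda>i. n - Suc i" "\<lambda>i. n - Suc i"]) (use that in auto)
      with C[of "n - k"] show ?thesis by simp
    qed
  qed (use a in \<open>auto intro: monoD\<close>)
  finally show ?thesis by simp
qed

text \<open>A geometric sum with numerator at most 2 in modulus and denominator
  \<open>1 - cis \<theta>\<close>.\<close>

lemma norm_sum_cis_le:
  assumes "sin (\<theta> / 2) \<noteq> 0"
  shows "norm (\<Sum>i<k. cis (\<theta> * real i)) \<le> 1 / \<bar>sin (\<theta> / 2)\<bar>"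
proof -
  have n1: "norm (1 - cis \<theta>) = 2 * \<bar>sin (\<theta> / 2)\<bar>"
  proof -
    have "cis \<theta> = cis (\<theta> / 2) * cis (\<theta> / 2)" by (simp add: cis_mult)
    then have "1 - cis \<theta> = cis (\<theta> / 2) * (cis (- (\<theta> / 2)) - cis (\<theta> / 2))"
      by (simp add: algebra_simps cis_mult)
    also have "cis (- (\<theta> / 2)) - cis (\<theta> / 2) = - (2 * \<i> * of_real (sin (\<theta> / 2)))"
      by (simp add: complex_eq_iff)
    finally show ?thesis by (simp add: norm_mult)
  qed
  then have ne: "cis \<theta> \<noteq> 1" using assms by auto
  have "(\<Sum>i<k. cis (\<theta> * real i)) = (\<Sum>i<k. cis \<theta> ^ i)"
    by (simp add: Complex.DeMoivre mult.commute)
  also have "\<dots> = (1 - cis \<theta> ^ k) / (1 - cis \<theta>)"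
    using ne by (simp add: geometric_sum divide_simps) (simp add: algebra_simps)
  also have "norm \<dots> \<le> 2 / norm (1 - cis \<theta>)"
    unfolding norm_divide
    by (intro divide_right_mono order_trans[OF norm_triangle_ineq4]) (auto simp: norm_power)
  finally show ?thesis unfolding n1 by simp
qed

text \<open>The lower limit \<open>k\<close> is free because \<open>abel_bound_increasing\<close>
  asks for all final segments. The trivial bound extends the sum to the full range; the cosecant
  bound uses that the weights \<open>E * \<rho> ^ h\<close> decrease and are at most 1.\<close>

lemma damped_geometric_bound:
  assumes \<rho>: "0 \<le> \<rho>" "\<rho> \<le> 1" and E: "0 \<le> E" "E \<le> 1"
  shows "norm (\<Sum>h=k..<H. of_real (E * \<rho> ^ h) * cis (\<theta> * real h))
    \<le> min_csc (E * (\<Sum>h<H. \<rho> ^ h)) (\<theta> / 2)"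
proof -
  let ?S = "\<Sum>h=k..<H. of_real (E * \<rho> ^ h) * cis (\<theta> * real h) :: complex"
  have "norm ?S \<le> (\<Sum>h=k..<H. E * \<rho> ^ h)"
    by (intro sum_norm_le) (use \<rho> E in \<open>auto simp: norm_mult norm_power\<close>)
  also have "\<dots> \<le> (\<Sum>h<H. E * \<rho> ^ h)"
    by (intro sum_mono2) (use \<rho> E in auto)
  finally have 1: "norm ?S \<le> E * (\<Sum>h<H. \<rho> ^ h)"
    by (simp add: sum_distrib_left)
  have "norm ?S \<le> 1 / \<bar>sin (\<theta> / 2)\<bar>" if sn: "sin (\<theta> / 2) \<noteq> 0"
  proof -
    have "?S = (\<Sum>i<H - k. of_real (E * \<rho> ^ (k + i)) * cis (\<theta> * real (k + i)))"
      by (rule sum.reindex_bij_witness[of _ "\<lambda>i. k + i" "\<lambda>i. i - k"]) auto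
    also have "norm \<dots> \<le> E * \<rho> ^ (k + 0) * (1 / \<bar>sin (\<theta> / 2)\<bar>)"
    proof (rule abel_bound_decreasing)
      show "E * \<rho> ^ (k + Suc i) \<le> E * \<rho> ^ (k + i)" for i
        by (intro mult_left_mono power_decreasing) (use \<rho> E in auto)
      fix n
      have "norm (\<Sum>i<n. cis (\<theta> * real (k + i))) = norm (cis (\<theta> * real k) * (\<Sum>i<n. cis (\<theta> * real i)))"
        by (simp add: sum_distrib_left cis_mult ring_distribs)
      also have "\<dots> \<le> 1 / \<bar>sin (\<theta> / 2)\<bar>"
        using norm_sum_cis_le[OF sn] by (simp add: norm_mult)
      finally show "norm (\<Sum>i<n. cis (\<theta> * real (k + i))) \<le> 1 / \<bar>sin (\<theta> / 2)\<bar>" .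
    qed (use \<rho> E in auto)
    also have "\<dots> \<le> 1 * (1 / \<bar>sin (\<theta> / 2)\<bar>)"
      by (intro mult_right_mono) (use \<rho> E in \<open>auto intro: mult_le_one power_le_one\<close>)
    finally show ?thesis by simp
  qed
  with 1 show ?thesis by (simp add: min_csc_def)
qed

lemma min_csc_nonneg: "x \<ge> 0 \<Longrightarrow> min_csc x y \<ge> 0"
  by (simp add: min_csc_def)

section \<open>Characters modulo prime powers in arithmetic progressions\<close>

text \<open>The first inequality makes \<open>p\<close> divide \<open>p ^ bexp a\<close>; the last
  makes \<open>p ^ a\<close> divide its square.\<close>

lemma bexp_bounds:
  assumes "a \<ge> 1"
  shows "1 \<le> bexp a" "bexp a \<le> a" "a \<le> 2 * bexp a"
proof -
  have "int (bexp a) = \<lceil>real a / 2\<rceil>" by (simp add: bexp_def)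
  then show "1 \<le> bexp a" "bexp a \<le> a" "a \<le> 2 * bexp a"
    using assms by linarith+
qed

context
  fixes chi :: "nat \<Rightarrow> complex" and p a :: nat
  assumes chi: "dirichlet_character (p ^ a) chi" and p: "prime p" and a: "a \<ge> 1"
begin

lemma chi_mult: "chi (m * n) = chi m * chi n"
  using chi by (auto simp: dirichlet_character_def)

lemma chi_add_multiple: "chi (n + k * p ^ a) = chi n"
proof (induction k)
  case (Suc k)
  have "chi (n + k * p ^ a + p ^ a) = chi (n + k * p ^ a)"
    using chi unfolding dirichlet_character_def by blast
  then show ?case using Suc by (simp add: algebra_simps)
qed simp

lemma chi_cong:
  assumes "[m = n] (mod p ^ a)"
  shows "chi m = chi n"
proof -
  have "chi k = chi (k mod p ^ a)" for k
    using chi_add_multiple[of "k mod p ^ a" "k div p ^ a"] by (simp add: mult.commute)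
  with assms show ?thesis by (metis cong_def)
qed

lemma chi_one: "chi 1 = 1"
proof -
  have "chi 1 \<noteq> 0" using chi by (simp add: dirichlet_character_def)
  with chi_mult[of 1 1] show ?thesis by simp
qed

lemma chi_power: "chi (n ^ k) = chi n ^ k"
  by (induction k) (use chi_one in \<open>simp_all add: chi_mult\<close>)

lemma chi_eq_0:
  assumes "\<not> coprime n p"
  shows "chi n = 0"
  using chi assms a by (auto simp: dirichlet_character_def)

text \<open>By Euler's theorem the nonzero values are roots of unity.\<close>

lemma norm_chi_le_1: "norm (chi n) \<le> 1"
proof (cases "coprime n (p ^ a)")
  case True
  have "chi n ^ totient (p ^ a) = chi 1"
    using chi_cong[OF euler_theorem[OF True]] by (simp add: chi_power)
  then have "norm (chi n) ^ totient (p ^ a) = 1"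
    by (metis chi_one norm_one norm_power)
  moreover have "totient (p ^ a) > 0"
    using p by (simp add: prime_gt_0_nat)
  ultimately show ?thesis
    using power_eq_imp_eq_base[of "norm (chi n)" "totient (p ^ a)" 1] by simp
next
  case False
  with chi have "chi n = 0" by (auto simp: dirichlet_character_def)
  then show ?thesis by simp
qed

text \<open>The square of \<open>q\<close> vanishes modulo \<open>p ^ a\<close>, so the binomial
  expansion of \<open>(1 + q) ^ x\<close> stops at the linear term.\<close>

lemma chi_one_plus_power:
  "chi (1 + p ^ bexp a * x) = chi (1 + p ^ bexp a) ^ x"
proof -
  define q where "q = p ^ bexp a"
  have qq: "[q * q = 0] (mod p ^ a)"
    using bexp_bounds[OF a] by (simp add: q_def cong_0_iff le_imp_power_dvd flip: power_add)
  have "[(1 + q) ^ x = 1 + q * x] (mod p ^ a)"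
  proof (induction x)
    case (Suc x)
    have "[(1 + q) ^ Suc x = (1 + q) * (1 + q * x)] (mod p ^ a)"
      unfolding power_Suc by (rule cong_mult[OF cong_refl Suc])
    also have "(1 + q) * (1 + q * x) = 1 + q * Suc x + q * q * x"
      by (simp add: algebra_simps)
    also have "[\<dots> = 1 + q * Suc x + 0 * x] (mod p ^ a)"
      by (intro cong_add cong_mult cong_refl qq)
    finally show ?case by simp
  qed simp
  from chi_cong[OF this] show ?thesis by (simp add: chi_power q_def)
qed

text \<open>This justifies the definite description in \<open>Lindex\<close>: as
  \<open>p ^ bexp a * N = p ^ a\<close>, the value is an \<open>N\<close>-th root of unity, and
  these correspond bijectively to \<open>l < N\<close>.\<close>

lemma Lindex_eq:
  "chi (1 + p ^ bexp a) = cis (2 * pi * real (Lindex p a chi) / real (p ^ (a - bexp a)))"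
proof -
  define N where "N = p ^ (a - bexp a)"
  define z where "z = chi (1 + p ^ bexp a)"
  have N: "N > 0" using p by (simp add: N_def prime_gt_0_nat)
  have "z ^ N = chi (1 + p ^ bexp a * N)"
    unfolding z_def by (rule chi_one_plus_power[symmetric])
  also have "p ^ bexp a * N = p ^ a"
    using bexp_bounds[OF a] by (simp add: N_def flip: power_add)
  also have "chi (1 + p ^ a) = 1"
    using chi_add_multiple[of 1 1] chi_one by simp
  finally have zN: "z ^ N = 1" .
  have ex: "\<exists>!l. l \<in> {..<N} \<and> cis (2 * pi * real l / real N) = z"
    using Complex.bij_betw_roots_unity[OF N] zN unfolding bij_betw_iff_bijections
    by (smt (verit, best) mem_Collect_eq)
  have eq: "exp (2 * of_real pi * \<i> * of_nat l / of_nat N) = cis (2 * pi * real l / real N)" for l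
    by (simp add: cis_conv_exp mult_ac)
  have "\<exists>!l. l < N \<and> z = exp (2 * of_real pi * \<i> * of_nat l / of_nat N)"
    using ex unfolding eq by (auto simp: eq_commute)
  from theI'[OF this] show ?thesis
    unfolding eq unfolding Lindex_def N_def[symmetric] z_def[symmetric] eq by simp
qed

text \<open>With an inverse \<open>i\<close> of \<open>n\<close> modulo \<open>p ^ a\<close>,
  \<open>n + q * h\<close> is congruent to \<open>n * (1 + q * (i * h))\<close> for
  \<open>q = p ^ bexp a\<close>, so \<open>h\<close> enters only through a power of
  \<open>chi (1 + q)\<close>.\<close>

lemma chi_progression:
  assumes n: "coprime n p"
  shows "chi (n + p ^ bexp a * h) = chi n *
    cis (2 * pi * real_of_int (modular_inverse (int (p ^ a)) (int n)) * real (Lindex p a chi)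
             / real (p ^ (a - bexp a)) * real h)"
proof -
  define i where "i = nat (modular_inverse (int (p ^ a)) (int n))"
  have i: "modular_inverse (int (p ^ a)) (int n) = int i"
    unfolding i_def using p by (subst int_nat_eq) (simp add: modular_inverse_int_nonneg prime_gt_0_nat)
  have "[int n * int i = 1] (mod int (p ^ a))"
    unfolding i[symmetric] using n a by (intro cong_modular_inverse1) simp
  then have ni: "[n * i = 1] (mod p ^ a)"
    by (simp flip: cong_int_iff)
  have "[n + (n * i) * (p ^ bexp a * h) = n + 1 * (p ^ bexp a * h)] (mod p ^ a)"
    by (intro cong_add cong_mult cong_refl ni)
  then have "chi (n + p ^ bexp a * h) = chi (n * (1 + p ^ bexp a * (i * h)))"
    by (intro chi_cong) (simp add: cong_sym_eq algebra_simps)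
  also have "\<dots> = chi n * chi (1 + p ^ bexp a) ^ (i * h)"
    by (simp only: chi_mult chi_one_plus_power)
  also have "\<dots> = chi n * cis (2 * pi * real i * real (Lindex p a chi) / real (p ^ (a - bexp a)) * real h)"
    unfolding Lindex_eq Complex.DeMoivre by (simp add: mult_ac)
  finally show ?thesis unfolding i by simp
qed

end

section \<open>The error of a single block\<close>

text \<open>Each derivative brings down a factor \<open>k\<close>; division by \<open>v ^ j\<close>
  will turn these into the weights \<open>(k / v) ^ j\<close>. For \<open>j = 0\<close> the term
  \<open>k = 0\<close> survives because \<open>0 ^ 0 = 1\<close>.\<close>

lemma higher_deriv_gsum_char:
  "(deriv ^^ j) (gsum_char K chi v) = (\<lambda>z. \<Sum>k<K. chi (v + k) * of_nat k ^ j * exp (of_nat k * z))"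
proof (induction j)
  case 0
  show ?case by (simp add: gsum_char_def fun_eq_iff)
next
  case (Suc j)
  have "deriv (\<lambda>z. \<Sum>k<K. chi (v + k) * of_nat k ^ j * exp (of_nat k * z)) z
      = (\<Sum>k<K. chi (v + k) * of_nat k ^ Suc j * exp (of_nat k * z))" for z
    by (rule DERIV_imp_deriv)
      (auto intro!: derivative_eq_intros sum.cong simp: mult_ac)
  then show ?case by (simp add: Suc fun_eq_iff)
qed

text \<open>Identifies \<open>Hcount\<close> as the number of members of the class of
  \<open>d\<close> below \<open>K\<close>; truncation by \<open>nat\<close> covers
  \<open>d \<ge> K\<close>.\<close>

lemma less_nat_ceiling_iff:
  assumes "q > 0"
  shows "h < nat \<lceil>(real K - real d) / real q\<rceil> \<longleftrightarrow> d + q * h < K"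
proof -
  have "h < nat \<lceil>(real K - real d) / real q\<rceil> \<longleftrightarrow> real h < (real K - real d) / real q"
    by (simp add: zless_nat_eq_int_zless less_ceiling_iff)
  also have "\<dots> \<longleftrightarrow> real (d + q * h) < real K"
    using assms by (simp add: field_simps)
  finally show ?thesis by (simp only: of_nat_less_iff)
qed

lemma sum_residue_classes:
  fixes f :: "nat \<Rightarrow> 'a :: comm_monoid_add"
  assumes q: "q > 0"
  shows "(\<Sum>k<K. f k) = (\<Sum>d<q. \<Sum>h<nat \<lceil>(real K - real d) / real q\<rceil>. f (d + q * h))"
proof -
  have "(\<Sum>k<K. f k)
      = (\<Sum>(d, h)\<in>(SIGMA d:{..<q}. {..<nat \<lceil>(real K - real d) / real q\<rceil>}). f (d + q * h))"
    by (rule sum.reindex_bij_witness[of _ "\<lambda>(d, h). d + q * h" "\<lambda>k. (k mod q, k div q)"])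
      (use q in \<open>auto simp: less_nat_ceiling_iff\<close>)
  then show ?thesis by (simp add: sum.Sigma)
qed

context
  fixes chi :: "nat \<Rightarrow> complex" and p a :: nat
  assumes chi: "dirichlet_character (p ^ a) chi" and p: "prime p" and a: "a \<ge> 1"
begin

text \<open>Along a residue class each summand is a fixed factor of modulus at most 1, times an
  increasing weight, times a damped exponential. Abel summation trades the weight for its last
  value, at most \<open>1 / u ^ j\<close>.\<close>

lemma residue_class_sum_bound:
  fixes s :: complex and d v j H :: nat
  defines "q \<equiv> p ^ bexp a"
  assumes s: "Re s > 0" and v: "v > 0" and n: "coprime (v + d) p" and u: "u > 0"
    and small: "\<And>h. h < H \<Longrightarrow> real (d + q * h) / real v \<le> 1 / u"
  shows "norm (\<Sum>h<H. chi (v + (d + q * h)) * of_real (real (d + q * h) / real v) ^ j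
             * exp (- s * of_real (real (d + q * h) / real v)))
    \<le> min_csc (exp (- Re s * real d / v) * (\<Sum>h<H. exp (real h * (- real q * Re s / v))))
        (2 * pi * real_of_int (modular_inverse (int (p ^ a)) (int (v + d))) * real (Lindex p a chi)
             / real (p ^ (a - bexp a)) / 2 - real q * Im s / (2 * v)) / u ^ j"
    (is "norm ?S \<le> min_csc ?x ?y / _")
proof -
  define w where "w = 2 * pi * real_of_int (modular_inverse (int (p ^ a)) (int (v + d)))
    * real (Lindex p a chi) / real (p ^ (a - bexp a))"
  \<comment> \<open>The phase per unit step of \<open>h\<close>: \<open>w\<close> from the
    character, the rest from \<open>exp (- s * x h)\<close>.\<close>
  define \<theta> where "\<theta> = w - real q * Im s / v"
  define \<rho> where "\<rho> = exp (- real q * Re s / v)"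
  define E where "E = exp (- Re s * real d / v)"
  define B where "B = min_csc (E * (\<Sum>h<H. \<rho> ^ h)) (\<theta> / 2)"
  define x where "x h = real (d + q * h) / real v" for h
  have B0: "B \<ge> 0"
    unfolding B_def by (intro min_csc_nonneg mult_nonneg_nonneg sum_nonneg) (auto simp: E_def \<rho>_def)
  have term_eq: "chi (v + (d + q * h)) * of_real (x h) ^ j * exp (- s * of_real (x h))
      = chi (v + d) * cis (- Im s * real d / v) *
        (of_real (x h ^ j) * (of_real (E * \<rho> ^ h) * cis (\<theta> * real h)))" for h
  proof -
    have "chi (v + (d + q * h)) = chi (v + d) * cis (w * real h)"
      using chi_progression[OF chi p a n, of h] by (simp add: w_def q_def add_ac)
    moreover have "exp (- s * of_real (x h)) = of_real (E * \<rho> ^ h) * cis (- Im s * x h)"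
    proof -
      have "exp (- s * of_real (x h)) = of_real (exp (- Re s * x h)) * cis (- Im s * x h)"
        by (simp add: exp_eq_polar)
      also have "exp (- Re s * x h) = E * \<rho> ^ h"
        using v by (simp add: E_def \<rho>_def x_def field_simps flip: exp_of_nat_mult exp_add)
      finally show ?thesis .
    qed
    moreover have "cis (w * real h) * cis (- Im s * x h) = cis (- Im s * real d / v) * cis (\<theta> * real h)"
    proof -
      have "w * real h + - Im s * x h = - Im s * real d / v + \<theta> * real h"
        using v by (simp add: x_def \<theta>_def field_simps)
      then show ?thesis by (simp only: cis_mult)
    qed
    ultimately show ?thesis by (simp add: mult_ac)
  qed
  have "?S = chi (v + d) * cis (- Im s * real d / v) *
      (\<Sum>h<H. of_real (x h ^ j) * (of_real (E * \<rho> ^ h) * cis (\<theta> * real h)))"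
    unfolding x_def[symmetric] term_eq by (simp only: sum_distrib_left)
  also have "norm \<dots> \<le> 1 * norm (\<Sum>h<H. of_real (x h ^ j) * (of_real (E * \<rho> ^ h) * cis (\<theta> * real h)))"
    unfolding norm_mult using norm_chi_le_1[OF chi p a, of "v + d"]
    by (intro mult_right_mono) auto
  also have "\<dots> \<le> B / u ^ j"
  proof (cases "H = 0")
    \<comment> \<open>Only for a nonempty class is \<open>H - 1\<close> an index to which
      \<open>small\<close> applies.\<close>
    case False
    have "norm (\<Sum>h<H. of_real (x h ^ j) * (of_real (E * \<rho> ^ h) * cis (\<theta> * real h)))
        \<le> x (H - 1) ^ j * B"
    proof (rule abel_bound_increasing)
      show "mono (\<lambda>h. x h ^ j)"
        by (intro monoI power_mono) (auto simp: x_def divide_right_mono mult_left_mono)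
      show "norm (\<Sum>i=k..<H. of_real (E * \<rho> ^ i) * cis (\<theta> * real i)) \<le> B" for k
        unfolding B_def by (rule damped_geometric_bound) (use s v in \<open>auto simp: E_def \<rho>_def\<close>)
    qed (simp add: x_def)
    also have "\<dots> \<le> (1 / u) ^ j * B"
      using small[of "H - 1"] False B0
      by (intro mult_right_mono power_mono) (auto simp: x_def)
    finally show ?thesis by (simp add: power_divide)
  qed (use B0 u in simp)
  also have "B = min_csc ?x ?y"
    by (simp add: B_def E_def \<rho>_def \<theta>_def w_def diff_divide_distrib mult.commute[of _ 2]
      flip: exp_of_nat_mult)
  finally show ?thesis by simp
qed

end

text \<open>Writing \<open>v + k = v * (1 + z)\<close>, \<open>Ln\<close> is additive because both
  factors are positive reals.\<close>

lemma dirichlet_term_eq: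
  assumes v: "v > 0"
  shows "1 / of_nat (v + k) powr s
    = exp (- s * of_real (real k / real v)) * fs s (of_real (real k / real v)) / of_nat v powr s"
proof -
  define z where "z = real k / real v"
  have z: "z \<ge> 0" by (simp add: z_def)
  have "real (v + k) = real v * (1 + z)" using v by (simp add: z_def field_simps)
  then have "ln (real (v + k)) = ln (real v) + ln (1 + z)"
    using v z by (simp add: ln_mult)
  then have "Ln (of_nat (v + k)) = Ln (of_nat v) + Ln (1 + of_real z)"
    using v z Ln_of_real[of "1 + z"] by (simp add: Ln_of_nat del: of_nat_add)
  then have "1 / of_nat (v + k) powr s = exp (- s * (Ln (of_nat v) + Ln (1 + of_real z)))"
    using v by (simp add: powr_def exp_minus divide_inverse del: of_nat_add flip: Ln_of_nat)
  also have "- s * (Ln (of_nat v) + Ln (1 + of_real z))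
      = - s * of_real z + (s * of_real z - s * Ln (1 + of_real z)) + - (s * Ln (of_nat v))"
    by (simp add: algebra_simps)
  also have "exp \<dots> = exp (- s * of_real z) * fs s (of_real z) / of_nat v powr s"
    using v by (simp only: exp_add) (simp add: powr_def fs_def exp_minus divide_inverse)
  finally show ?thesis by (simp add: z_def)
qed

section \<open>The partition of the interval from \<open>v0\<close> to \<open>M\<close> into
  blocks\<close>

lemma vseq_ge: "v0 \<le> vseq u0 v0 r"
  by (induction r) auto

text \<open>Growth by at least 1 per step bounds the \<open>r\<close> with
  \<open>vseq u0 v0 r < M\<close>, so that a greatest one exists.\<close>

lemma vseq_ge_add:
  assumes "0 < u0" "0 < v0"
  shows "v0 + r \<le> vseq u0 v0 r"
proof (induction r)
  case (Suc r)
  have "0 < real (vseq u0 v0 r) / real u0"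
    using assms vseq_ge[of v0 u0 r] by simp
  then have "1 \<le> nat \<lceil>real (vseq u0 v0 r) / real u0\<rceil>"
    by linarith
  with Suc show ?case by simp
qed simp

text \<open>Dropping the ceiling, each step multiplies by at least \<open>1 + 1 / u0\<close>; this
  will bound the number of blocks.\<close>

lemma vseq_growth:
  assumes "0 < u0"
  shows "real v0 * (1 + 1 / u0) ^ r \<le> vseq u0 v0 r"
proof (induction r)
  case (Suc r)
  have "real v0 * (1 + 1 / u0) ^ Suc r \<le> vseq u0 v0 r * (1 + 1 / u0)"
    using mult_right_mono[OF Suc, of "1 + 1 / u0"] by (simp add: mult_ac)
  also have "\<dots> = vseq u0 v0 r + vseq u0 v0 r / u0" by (simp add: algebra_simps)
  also have "\<dots> \<le> vseq u0 v0 (Suc r)" by simp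
  finally show ?case .
qed simp

lemma Rlast_bracket:
  assumes "0 < u0" "0 < v0" "v0 < M"
  shows "vseq u0 v0 (Rlast u0 v0 M) < M" "M \<le> vseq u0 v0 (Suc (Rlast u0 v0 M))"
proof -
  let ?P = "\<lambda>r. vseq u0 v0 r < M"
  have bound: "r \<le> M" if "?P r" for r
    using vseq_ge_add[OF assms(1,2), of r] that by simp
  have R: "Rlast u0 v0 M = Greatest ?P" using assms by (simp add: Rlast_def)
  show "?P (Rlast u0 v0 M)"
    unfolding R by (rule GreatestI_nat[of ?P 0 M]) (use assms bound in auto)
  show "M \<le> vseq u0 v0 (Suc (Rlast u0 v0 M))"
  proof (rule ccontr)
    assume "\<not> M \<le> vseq u0 v0 (Suc (Rlast u0 v0 M))"
    then have "Suc (Rlast u0 v0 M) \<le> Greatest ?P"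
      by (intro Greatest_le_nat[of ?P _ M] bound) auto
    with R show False by simp
  qed
qed

lemma sum_blocks:
  fixes f :: "nat \<Rightarrow> 'a :: comm_monoid_add"
  assumes "0 < u0" "0 < v0" "v0 \<le> M"
  shows "(\<Sum>r=0..Rlast u0 v0 M. \<Sum>k<Kblock u0 v0 M r. f (vseq u0 v0 r + k)) = (\<Sum>n=v0..<M. f n)"
proof (cases "M = v0")
  \<comment> \<open>The only block has length 0.\<close>
  case True
  then show ?thesis by (simp add: Rlast_def Kblock_def)
next
  case False
  define R where "R = Rlast u0 v0 M"
  have R: "vseq u0 v0 R < M" "M \<le> vseq u0 v0 (Suc R)"
    unfolding R_def using assms False by (auto intro!: Rlast_bracket simp del: vseq.simps)
  have shift: "(\<Sum>k<K. f (v + k)) = (\<Sum>n=v..<v + K. f n)" for v K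
    by (rule sum.reindex_bij_witness[of _ "\<lambda>n. n - v" "\<lambda>k. v + k"]) auto
  have full: "(\<Sum>r<n. \<Sum>k<nat \<lceil>real (vseq u0 v0 r) / real u0\<rceil>. f (vseq u0 v0 r + k))
      = (\<Sum>n=v0..<vseq u0 v0 n. f n)" for n
  proof (induction n)
    case (Suc n)
    then show ?case
      using vseq_ge[of v0 u0 n] by (simp add: shift sum.atLeastLessThan_concat)
  qed simp
  have "(\<Sum>r=0..R. \<Sum>k<Kblock u0 v0 M r. f (vseq u0 v0 r + k))
      = (\<Sum>r<R. \<Sum>k<Kblock u0 v0 M r. f (vseq u0 v0 r + k))
        + (\<Sum>k<Kblock u0 v0 M R. f (vseq u0 v0 R + k))"
    by (simp add: atLeast0AtMost flip: lessThan_Suc_atMost)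
  also have "(\<Sum>r<R. \<Sum>k<Kblock u0 v0 M r. f (vseq u0 v0 r + k)) = (\<Sum>n=v0..<vseq u0 v0 R. f n)"
    unfolding full[symmetric] by (intro sum.cong) (auto simp: Kblock_def R_def)
  \<comment> \<open>The next point of the sequence is at least \<open>M\<close>, so the minimum in
    \<open>Kblock\<close> is the distance to \<open>M\<close>.\<close>
  also have "Kblock u0 v0 M R = M - vseq u0 v0 R"
    using R by (simp add: Kblock_def R_def)
  also have "(\<Sum>k<M - vseq u0 v0 R. f (vseq u0 v0 R + k)) = (\<Sum>n=vseq u0 v0 R..<M. f n)"
    using R by (simp add: shift)
  also have "(\<Sum>n=v0..<vseq u0 v0 R. f n) + \<dots> = (\<Sum>n=v0..<M. f n)"
    using R vseq_ge[of v0 u0 R] by (simp add: sum.atLeastLessThan_concat)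
  finally show ?thesis by (simp add: R_def)
qed

text \<open>An integer below a ceiling is strictly below the real number itself; this gives
  \<open>k / v < 1 / u0\<close>.\<close>

lemma less_Kblock_imp:
  assumes "k < Kblock u0 v0 M r"
  shows "real k < real (vseq u0 v0 r) / real u0"
proof -
  have "k < nat \<lceil>real (vseq u0 v0 r) / real u0\<rceil>"
    using assms by (auto simp: Kblock_def split: if_splits)
  then show ?thesis by linarith
qed

text \<open>Interchanging the finite sum over \<open>k\<close> with the Taylor series gives a series
  in \<open>c j * A j\<close> whose part up to \<open>j = m\<close> is \<open>Bterm\<close>.
  Bounding \<open>A j\<close> class by class supplies the constant for
  \<open>tail_bound\<close>.\<close>

lemma block_bound:
  fixes u0 v0 M r :: nat
  assumes s: "Re s > 0" and p: "prime p" and a: "a \<ge> 1"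
    and chi: "dirichlet_character (p ^ a) chi" and v0: "v0 \<ge> u0"
    and u: "real u0 \<ge> 12" "real u0 \<ge> 2 * sqrt (frakq s)"
  defines "v \<equiv> vseq u0 v0 r" and "K \<equiv> Kblock u0 v0 M r"
  shows "norm ((\<Sum>k<K. chi (v + k) / of_nat (v + k) powr s) - Bterm u0 v0 M r s chi m / of_nat v powr s)
    \<le> eps m s (real u0) * (\<Sum>d<p ^ bexp a.
        let v = real (vseq u0 v0 r) in
        if coprime (vseq u0 v0 r + d) p
        then min_csc
               (exp (- Re s * real d / v) *
                gsum (Hcount p a u0 v0 M r d) (- real (p ^ bexp a) * Re s / v))
               (wphase p a chi u0 v0 r d / 2 - real (p ^ bexp a) * Im s / (2 * v))
             * v powr (- Re s)
        else 0)"
proof -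
  define q where "q = p ^ bexp a"
  define H where "H d = nat (Hcount p a u0 v0 M r d)" for d
  define c where "c j = (deriv ^^ j) (fs s) 0 / fact j" for j
  define z where "z k = real k / real v" for k
  define A where "A j = (\<Sum>k<K. chi (v + k) * of_real (z k) ^ j * exp (- s * of_real (z k)))" for j
  define D where "D d = (if coprime (v + d) p then min_csc
               (exp (- Re s * real d / v) * gsum (Hcount p a u0 v0 M r d) (- real q * Re s / v))
               (wphase p a chi u0 v0 r d / 2 - real q * Im s / (2 * real v)) else 0)" for d
  have u0: "u0 > 0" using u by simp
  have v: "v > 0" using vseq_ge[of v0 u0 r] v0 u0 by (simp add: v_def)
  have q: "q > 0" using p by (simp add: q_def prime_gt_0_nat)
  have z: "0 \<le> z k" "z k \<le> 1 / real u0" if "k < K" for k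
    using less_Kblock_imp[of k u0 v0 M r] that u0 v by (auto simp: z_def K_def v_def field_simps)
  have D0: "D d \<ge> 0" for d
    by (auto simp: D_def gsum_def intro!: min_csc_nonneg mult_nonneg_nonneg sum_nonneg)
  have A_bound: "norm (A j) \<le> (\<Sum>d<q. D d) / real u0 ^ j" for j
  proof -
    let ?f = "\<lambda>k. chi (v + k) * of_real (z k) ^ j * exp (- s * of_real (z k))"
    have "A j = (\<Sum>d<q. \<Sum>h<H d. ?f (d + q * h))"
      unfolding A_def by (subst sum_residue_classes[OF q]) (simp add: H_def Hcount_def q_def K_def)
    also have "norm \<dots> \<le> (\<Sum>d<q. D d / real u0 ^ j)"
    proof (rule sum_norm_le)
      fix d
      show "norm (\<Sum>h<H d. ?f (d + q * h)) \<le> D d / real u0 ^ j"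
      proof (cases "coprime (v + d) p")
        case True
        have "norm (\<Sum>h<H d. ?f (d + q * h))
          \<le> min_csc (exp (- Re s * real d / v) * (\<Sum>h<H d. exp (real h * (- real q * Re s / v))))
              (2 * pi * real_of_int (modular_inverse (int (p ^ a)) (int (v + d))) * real (Lindex p a chi)
                / real (p ^ (a - bexp a)) / 2 - real q * Im s / (2 * v)) / real u0 ^ j"
          unfolding q_def z_def
        proof (rule residue_class_sum_bound[OF chi p a s v True])
          fix h assume "h < H d"
          then have "d + q * h < K"
            using q by (simp add: H_def Hcount_def q_def[symmetric] K_def[symmetric] less_nat_ceiling_iff)
          from z(2)[OF this] show "real (d + p ^ bexp a * h) / real v \<le> 1 / real u0"
            by (simp add: z_def q_def)
        qed (use u0 in simp)
        then show ?thesis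
          using True by (simp add: D_def gsum_def H_def wphase_def v_def[symmetric])
      next
        case False
        \<comment> \<open>Since \<open>p\<close> divides both \<open>q\<close> and
          \<open>v + d\<close>, the character vanishes on the whole class.\<close>
        have "\<not> coprime (v + (d + q * h)) p" for h
        proof -
          have "p dvd v + d"
            using False p by (metis coprime_commute prime_imp_coprime)
          moreover have "p dvd q * h"
            unfolding q_def using bexp_bounds(1)[OF a] by (intro dvd_mult2 dvd_power) auto
          ultimately have "p dvd v + (d + q * h)"
            by (metis add.assoc dvd_add)
          then show ?thesis
            using p by (metis coprime_absorb_right not_prime_unit)
        qed
        then show ?thesis
          using D0[of d] by (simp add: chi_eq_0[OF chi p a])
      qed
    qed
    finally show ?thesis by (simp add: sum_divide_distrib)
  qed
  have sums: "(\<lambda>j. c j * A j) sums (\<Sum>k<K. chi (v + k) * exp (- s * of_real (z k)) * fs s (of_real (z k)))"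
  proof -
    have "(\<lambda>j. \<Sum>k<K. chi (v + k) * exp (- s * of_real (z k)) * (c j * of_real (z k) ^ j))
        sums (\<Sum>k<K. chi (v + k) * exp (- s * of_real (z k)) * fs s (of_real (z k)))"
    proof (intro sums_sum sums_mult)
      fix k assume "k \<in> {..<K}"
      then have "0 \<le> z k" "z k \<le> 1 / real u0" by (auto intro: z)
      \<comment> \<open>Keeps \<open>z k\<close> inside the disc where the Taylor series of
        \<open>fs s\<close> converges.\<close>
      moreover have "1 / real u0 < 1" using u by simp
      ultimately have "norm (of_real (z k) :: complex) < 1" by simp
      then show "(\<lambda>j. c j * of_real (z k) ^ j) sums fs s (of_real (z k))"
        unfolding c_def by (rule fs_sums)
    qed
    then show ?thesis by (simp add: A_def sum_distrib_left mult_ac)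
  qed
  have Bterm_eq: "Bterm u0 v0 M r s chi m = (\<Sum>j=0..m. c j * A j)"
    unfolding Bterm_def Let_def c_def A_def v_def[symmetric] K_def[symmetric] higher_deriv_gsum_char
    using v by (intro sum.cong refl arg_cong2[where f = "(*)"])
      (auto simp: sum_divide_distrib z_def power_divide mult_ac intro!: sum.cong)
  have "(\<Sum>k<K. chi (v + k) / of_nat (v + k) powr s) - Bterm u0 v0 M r s chi m / of_nat v powr s
      = ((\<Sum>k<K. chi (v + k) * exp (- s * of_real (z k)) * fs s (of_real (z k))) - (\<Sum>j=0..m. c j * A j))
        / of_nat v powr s"
  proof -
    have "chi (v + k) / of_nat (v + k) powr s
        = chi (v + k) * exp (- s * of_real (z k)) * fs s (of_real (z k)) / of_nat v powr s" for k
      using dirichlet_term_eq[OF v, of k s] by (simp add: z_def divide_inverse mult_ac)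
    then show ?thesis by (simp add: Bterm_eq sum_divide_distrib diff_divide_distrib)
  qed
  also have "norm \<dots> \<le> eps m s (real u0) * (\<Sum>d<q. D d) / norm (of_nat v powr s)"
    unfolding norm_divide c_def
    by (intro divide_right_mono tail_bound A_bound sums[unfolded c_def] u)
      (use s D0 in \<open>auto intro: sum_nonneg\<close>)
  also have "norm (of_nat v powr s :: complex) = real v powr Re s"
    by (subst norm_powr_real_powr) auto
  also have "eps m s (real u0) * (\<Sum>d<q. D d) / real v powr Re s
      = eps m s (real u0) * (\<Sum>d<q. D d * real v powr (- Re s))"
    by (simp add: powr_minus divide_inverse flip: sum_distrib_right)
  finally show ?thesis
    by (simp add: D_def q_def v_def Let_def if_distrib[of "\<lambda>x. x * _"] cong: if_cong)
qed

section \<open>Assembly of the blocks and the bound on their number\<close>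

text \<open>\<open>dirichlet_L\<close> cancels against \<open>L_remainder\<close>, leaving the
  finite sum over \<open>v0 \<le> n < M\<close>, which splits into blocks.\<close>

lemma T_remainder_eq_sum_blocks:
  assumes "0 < u0" "0 < v0" "v0 \<le> M"
  shows "T_remainder u0 v0 M m s chi = (\<Sum>r=0..Rlast u0 v0 M.
      (\<Sum>k<Kblock u0 v0 M r. chi (vseq u0 v0 r + k) / of_nat (vseq u0 v0 r + k) powr s)
      - Bterm u0 v0 M r s chi m / of_nat (vseq u0 v0 r) powr s)"
proof -
  have "(\<Sum>n=1..<M. chi n / of_nat n powr s)
      = (\<Sum>n=1..<v0. chi n / of_nat n powr s) + (\<Sum>n=v0..<M. chi n / of_nat n powr s)"
    using assms by (simp add: sum.atLeastLessThan_concat)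
  then show ?thesis
    unfolding T_remainder_def L_remainder_def sum_subtractf
      sum_blocks[OF assms, of "\<lambda>n. chi n / of_nat n powr s"]
    by simp
qed

text \<open>Take logarithms in \<open>vseq_growth\<close> and use that
  \<open>ln (1 + 1 / u0)\<close> is at least \<open>1 / (u0 + 1)\<close>, hence at least
  \<open>1 / (2 * u0)\<close>. For \<open>M = v0\<close> both sides reduce to constants and the
  added 1 gives strictness.\<close>

lemma Rlast_less:
  assumes "2 \<le> u0" "0 < v0" "v0 \<le> M"
  shows "real (Rlast u0 v0 M) < 2 * real u0 * ln (real M / real v0) + 1"
proof (cases "M = v0")
  case False
  define R where "R = Rlast u0 v0 M"
  have "vseq u0 v0 R < M"
    unfolding R_def using assms False by (intro Rlast_bracket) auto
  then have "real v0 * (1 + 1 / u0) ^ R < M"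
    using vseq_growth[of u0 v0 R] assms by simp
  then have "(1 + 1 / u0) ^ R < M / v0"
    using assms by (simp add: field_simps)
  then have "ln ((1 + 1 / u0) ^ R) < ln (M / v0)"
    by (subst ln_less_cancel_iff) (use assms in \<open>auto intro!: zero_less_power add_pos_nonneg\<close>)
  then have "R * ln (1 + 1 / real u0) < ln (M / v0)"
    by (simp add: ln_realpow add_pos_nonneg)
  moreover have "1 / (2 * real u0) \<le> ln (1 + 1 / real u0)"
  proof -
    have "- ln (1 + 1 / real u0) = ln (real u0 / (real u0 + 1))"
      using assms by (simp add: field_simps flip: ln_inverse)
    also have "\<dots> \<le> real u0 / (real u0 + 1) - 1"
      by (rule ln_le_minus_one) (use assms in simp)
    also have "\<dots> \<le> - (1 / (2 * real u0))"
      using assms by (simp add: field_simps)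
    finally show ?thesis by simp
  qed
  ultimately have "R * (1 / (2 * real u0)) < ln (M / v0)"
    by (meson mult_left_mono of_nat_0_le_iff order_le_less_trans)
  then show ?thesis
    using assms by (simp add: R_def field_simps)
qed (simp add: Rlast_def)

theorem theorem2:
  fixes s :: complex and chi :: "nat \<Rightarrow> complex" and p a u0 v0 M m :: nat
  assumes "Re s > 0"
    and "prime p" and "a \<ge> 1"
    and "dirichlet_character (p ^ a) chi"
    and "chi \<noteq> principal_character (p ^ a)"
    and "v0 \<ge> u0"
    and "real u0 \<ge> 2 * Max {6, sqrt (frakq s), Re s}"
    and "M \<ge> v0"
  shows "dirichlet_L s chi =
           (\<Sum>n=1..<v0. chi n / of_nat n powr s)
           + (\<Sum>r=0..Rlast u0 v0 M. Bterm u0 v0 M r s chi m / of_nat (vseq u0 v0 r) powr s)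
           + T_remainder u0 v0 M m s chi
           + L_remainder M s chi
         \<and> cmod (T_remainder u0 v0 M m s chi) \<le> eps m s (real u0) * Bbound p a M s chi u0 v0
         \<and> real (Rlast u0 v0 M) < 2 * real u0 * ln (real M / real v0) + 1"
proof (intro conjI)
  \<comment> \<open>The 12 comes from the entry 6 in the maximum.\<close>
  have u: "real u0 \<ge> 12" "real u0 \<ge> 2 * sqrt (frakq s)"
    using assms(7) by (auto simp: max_def split: if_splits)
  then have pos: "0 < u0" "0 < v0"
    using assms(6) by auto
  \<comment> \<open>\<open>T_remainder\<close> is by definition the term that makes this identity
    hold.\<close>
  show "dirichlet_L s chi =
           (\<Sum>n=1..<v0. chi n / of_nat n powr s)
           + (\<Sum>r=0..Rlast u0 v0 M. Bterm u0 v0 M r s chi m / of_nat (vseq u0 v0 r) powr s)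
           + T_remainder u0 v0 M m s chi
           + L_remainder M s chi"
    by (simp add: T_remainder_def)
  show "cmod (T_remainder u0 v0 M m s chi) \<le> eps m s (real u0) * Bbound p a M s chi u0 v0"
    \<comment> \<open>The instantiated index set moves \<open>eps\<close> into the outer sum over
      \<open>r\<close> only, so that each summand has the shape of
      \<open>block_bound\<close>.\<close>
    unfolding T_remainder_eq_sum_blocks[OF pos assms(8)] Bbound_def sum_distrib_left[of _ _ "{0.._}"]
    by (intro sum_norm_le block_bound assms u)
  show "real (Rlast u0 v0 M) < 2 * real u0 * ln (real M / real v0) + 1"
    by (rule Rlast_less) (use u pos assms(8) in auto)
qed

end
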